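(* Let $X$ be a Banach space, let $E$ be a Banach lattice, and let $T:X\to E$ be an operator. The following assertions are equivalent: (1) $T$ is weak almost limited. (2) If $S:Z\to X$ is a weakly compact operator, where $Z$ is an arbitrary Banach space, then the operator $T\circ S$ is almost limited. (3) If $S:\ell^1\to X$ is a weakly compact operator, then the operator $T\circ S$ is almost limited. (4) For every weakly null sequence $(x_n)\subset X$ and every disjoint weak* null sequence $(f_n)\subset E^*$ we have $f_n(Tx_n)\to 0$.
   Context: All Banach spaces and Banach lattices are real; "operator" means bounded linear mapping. $B_X$ denotes the closed unit ball of $X$. A sequence $(f_n)$ in a Banach lattice is disjoint if $|f_n|\wedge|f_m|=0$ for $n\neq m$. A norm bounded subset $A$ of a Banach lattice $E$ is an almost limited set if every disjoint weak* null sequence $(f_n)$ in $E^*$ converges uniformly to zero on $A$, i.e. $\sup_{x\in A}|f_n(x)|\to 0$. An operator $T:X\to E$ from a Banach space into a Banach lattice is almost limited if $T(B_X)$ is an almost limited set in $E$ (equivalently, $\|T^*f_n\|\to 0$ for every disjoint weak* null sequence $(f_n)\subset E^*$). An operator $T:X\to E$ is weak almost limited if $T$ carries each relatively weakly compact set in $X$ to an almost limited set in $E$. *)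

theory Defs
  imports "HOL-Analysis.Analysis" "HOL-Library.Lattice_Algebras"
begin

subsection \<open>Banach lattices\<close>

text \<open>In \<^class>\<open>lattice_ab_group_add_abs\<close> the modulus is \<open>\<bar>x\<bar> = sup x (- x)\<close>.\<close>

class banach_lattice = banach + ordered_real_vector + lattice_ab_group_add_abs +
  assumes lattice_norm: "\<bar>x\<bar> \<le> \<bar>y\<bar> \<Longrightarrow> norm x \<le> norm y"

instance real :: banach_lattice
  by standard simp

subsection \<open>The order dual structure of \<open>E\<^sup>*\<close>\<close>

definition dual_le :: "('e::banach_lattice \<Rightarrow>\<^sub>L real) \<Rightarrow> ('e \<Rightarrow>\<^sub>L real) \<Rightarrow> bool"
  where "dual_le f g \<longleftrightarrow> (\<forall>x\<ge>0. blinfun_apply f x \<le> blinfun_apply g x)"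

definition is_dual_sup ::
    "('e::banach_lattice \<Rightarrow>\<^sub>L real) \<Rightarrow> ('e \<Rightarrow>\<^sub>L real) \<Rightarrow> ('e \<Rightarrow>\<^sub>L real) \<Rightarrow> bool"
  where "is_dual_sup f g h \<longleftrightarrow> dual_le f h \<and> dual_le g h \<and>
    (\<forall>k. dual_le f k \<and> dual_le g k \<longrightarrow> dual_le h k)"

definition is_dual_inf ::
    "('e::banach_lattice \<Rightarrow>\<^sub>L real) \<Rightarrow> ('e \<Rightarrow>\<^sub>L real) \<Rightarrow> ('e \<Rightarrow>\<^sub>L real) \<Rightarrow> bool"
  where "is_dual_inf f g h \<longleftrightarrow> dual_le h f \<and> dual_le h g \<and>
    (\<forall>k. dual_le k f \<and> dual_le k g \<longrightarrow> dual_le k h)"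

text \<open>\<open>\<bar>f\<bar> \<and> \<bar>g\<bar> = 0\<close> in \<open>E\<^sup>*\<close>. The witnesses \<open>u = \<bar>f\<bar> = f \<or> (- f)\<close> and \<open>v = \<bar>g\<bar>\<close>
  always exist (Riesz-Kantorovich) and are unique.\<close>

definition dual_disjoint :: "('e::banach_lattice \<Rightarrow>\<^sub>L real) \<Rightarrow> ('e \<Rightarrow>\<^sub>L real) \<Rightarrow> bool"
  where "dual_disjoint f g \<longleftrightarrow>
    (\<exists>u v. is_dual_sup f (- f) u \<and> is_dual_sup g (- g) v \<and> is_dual_inf u v 0)"

definition disjoint_dual_seq :: "(nat \<Rightarrow> ('e::banach_lattice \<Rightarrow>\<^sub>L real)) \<Rightarrow> bool"
  where "disjoint_dual_seq f \<longleftrightarrow> (\<forall>n m. n \<noteq> m \<longrightarrow> dual_disjoint (f n) (f m))"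

subsection \<open>Weak and weak* topologies\<close>

text \<open>The coarsest topology making all functionals in \<open>X\<^sup>*\<close> continuous; \<open>euclidean\<close> on
  functions is the product topology.\<close>

definition weak_topology :: "'x::real_normed_vector topology"
  where "weak_topology =
    pullback_topology UNIV (\<lambda>x (f :: 'x \<Rightarrow>\<^sub>L real). blinfun_apply f x) euclidean"

definition weakly_null :: "(nat \<Rightarrow> 'x::real_normed_vector) \<Rightarrow> bool"
  where "weakly_null x \<longleftrightarrow> limitin weak_topology x 0 sequentially"

text \<open>For scalar-valued maps the strong operator topology is the weak* topology.\<close>

definition weak_star_null :: "(nat \<Rightarrow> ('x::real_normed_vector \<Rightarrow>\<^sub>L real)) \<Rightarrow> bool"
  where "weak_star_null f \<longleftrightarrow> limitin strong_operator_topology f 0 sequentially"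

definition relatively_weakly_compact :: "'x::real_normed_vector set \<Rightarrow> bool"
  where "relatively_weakly_compact A \<longleftrightarrow> compactin weak_topology (weak_topology closure_of A)"

subsection \<open>Banach spaces on a carrier set\<close>

text \<open>A type class cannot be quantified over inside a formula, so Banach spaces that are
  bound variables are structures whose points form a subset of a type. For "every Banach
  space" that type is taken to be \<open>'z + (nat \<Rightarrow> real)\<close> with \<open>'z\<close> a free type variable: it
  contains a copy of any prescribed space (in \<open>'z\<close>) and of \<open>\<ell>\<^sup>1\<close>.\<close>

record 'z normed_structure =
  vcarrier :: "'z set"
  vadd :: "'z \<Rightarrow> 'z \<Rightarrow> 'z"
  vzero :: "'z"
  vscale :: "real \<Rightarrow> 'z \<Rightarrow> 'z"
  vnorm :: "'z \<Rightarrow> real"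

definition vdist :: "'z normed_structure \<Rightarrow> 'z \<Rightarrow> 'z \<Rightarrow> real"
  where "vdist Z x y = vnorm Z (vadd Z x (vscale Z (- 1) y))"

locale banach_space =
  fixes Z :: "'z normed_structure"
  assumes zero_closed: "vzero Z \<in> vcarrier Z"
    and add_closed: "x \<in> vcarrier Z \<Longrightarrow> y \<in> vcarrier Z \<Longrightarrow> vadd Z x y \<in> vcarrier Z"
    and scale_closed: "x \<in> vcarrier Z \<Longrightarrow> vscale Z c x \<in> vcarrier Z"
    and add_assoc: "x \<in> vcarrier Z \<Longrightarrow> y \<in> vcarrier Z \<Longrightarrow> z \<in> vcarrier Z \<Longrightarrow>
      vadd Z (vadd Z x y) z = vadd Z x (vadd Z y z)"
    and add_commute: "x \<in> vcarrier Z \<Longrightarrow> y \<in> vcarrier Z \<Longrightarrow> vadd Z x y = vadd Z y x"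
    and add_zero: "x \<in> vcarrier Z \<Longrightarrow> vadd Z x (vzero Z) = x"
    and add_minus: "x \<in> vcarrier Z \<Longrightarrow> vadd Z x (vscale Z (- 1) x) = vzero Z"
    and scale_add_right: "x \<in> vcarrier Z \<Longrightarrow> y \<in> vcarrier Z \<Longrightarrow>
      vscale Z c (vadd Z x y) = vadd Z (vscale Z c x) (vscale Z c y)"
    and scale_add_left: "x \<in> vcarrier Z \<Longrightarrow>
      vscale Z (c + d) x = vadd Z (vscale Z c x) (vscale Z d x)"
    and scale_scale: "x \<in> vcarrier Z \<Longrightarrow> vscale Z c (vscale Z d x) = vscale Z (c * d) x"
    and scale_one: "x \<in> vcarrier Z \<Longrightarrow> vscale Z 1 x = x"
    and norm_eq_zero: "x \<in> vcarrier Z \<Longrightarrow> vnorm Z x = 0 \<longleftrightarrow> x = vzero Z"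
    and norm_scale: "x \<in> vcarrier Z \<Longrightarrow> vnorm Z (vscale Z c x) = \<bar>c\<bar> * vnorm Z x"
    and norm_triangle: "x \<in> vcarrier Z \<Longrightarrow> y \<in> vcarrier Z \<Longrightarrow>
      vnorm Z (vadd Z x y) \<le> vnorm Z x + vnorm Z y"
    and norm_complete: "(\<And>n. s n \<in> vcarrier Z) \<Longrightarrow>
      (\<And>e. e > 0 \<Longrightarrow> \<exists>N. \<forall>m\<ge>N. \<forall>n\<ge>N. vdist Z (s m) (s n) < e) \<Longrightarrow>
      \<exists>x\<in>vcarrier Z. (\<lambda>n. vdist Z (s n) x) \<longlonglongrightarrow> 0"

definition unit_ball :: "'z normed_structure \<Rightarrow> 'z set"
  where "unit_ball Z = {z \<in> vcarrier Z. vnorm Z z \<le> 1}"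

text \<open>Bounded linear maps from \<open>Z\<close> into a normed space; values off the carrier are irrelevant.\<close>

definition bounded_operator :: "'z normed_structure \<Rightarrow> ('z \<Rightarrow> 'x::real_normed_vector) \<Rightarrow> bool"
  where "bounded_operator Z S \<longleftrightarrow>
    (\<forall>x\<in>vcarrier Z. \<forall>y\<in>vcarrier Z. S (vadd Z x y) = S x + S y) \<and>
    (\<forall>c. \<forall>x\<in>vcarrier Z. S (vscale Z c x) = c *\<^sub>R S x) \<and>
    (\<exists>K. \<forall>x\<in>vcarrier Z. norm (S x) \<le> K * vnorm Z x)"

definition weakly_compact_operator ::
    "'z normed_structure \<Rightarrow> ('z \<Rightarrow> 'x::real_normed_vector) \<Rightarrow> bool"
  where "weakly_compact_operator Z S \<longleftrightarrow>
    bounded_operator Z S \<and> relatively_weakly_compact (S ` unit_ball Z)"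

definition ell1 :: "(nat \<Rightarrow> real) normed_structure"
  where "ell1 =
    \<lparr>vcarrier = {a. summable (\<lambda>n. \<bar>a n\<bar>)}, vadd = (\<lambda>a b n. a n + b n), vzero = (\<lambda>n. 0),
     vscale = (\<lambda>c a n. c * a n), vnorm = (\<lambda>a. \<Sum>n. \<bar>a n\<bar>)\<rparr>"

subsection \<open>Almost limited sets and operators\<close>

definition almost_limited_set :: "'e::banach_lattice set \<Rightarrow> bool"
  where "almost_limited_set A \<longleftrightarrow> bounded A \<and>
    (\<forall>f :: nat \<Rightarrow> ('e \<Rightarrow>\<^sub>L real). disjoint_dual_seq f \<and> weak_star_null f \<longrightarrow>
      uniform_limit A (\<lambda>n. blinfun_apply (f n)) (\<lambda>x. 0) sequentially)"

definition almost_limited_operator ::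
    "'z normed_structure \<Rightarrow> ('z \<Rightarrow> 'e::banach_lattice) \<Rightarrow> bool"
  where "almost_limited_operator Z R \<longleftrightarrow>
    bounded_operator Z R \<and> almost_limited_set (R ` unit_ball Z)"

definition weak_almost_limited :: "('x::banach \<Rightarrow>\<^sub>L 'e::banach_lattice) \<Rightarrow> bool"
  where "weak_almost_limited T \<longleftrightarrow>
    (\<forall>A. relatively_weakly_compact A \<longrightarrow> almost_limited_set (blinfun_apply T ` A))"

end

theory Submission
  imports Defs
begin

text \<open>Only two implications need work. If \<open>x\<close> is weakly null, then \<open>a \<mapsto> \<Sum>n. a n *\<^sub>R x n\<close> is a
  weakly compact operator on \<open>\<ell>\<^sup>1\<close>: it is continuous from the unit ball with coordinatewise
  convergence, which is compact, to the weak topology. It maps the unit vectors to \<open>x\<close>, so almost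
  limitedness of its composition with \<open>T\<close> gives the sequential condition. Conversely, a failure of
  uniform convergence on a relatively weakly compact set yields, by Eberlein-Smulian, a weakly
  convergent sequence on which it fails, and subtracting the limit makes that sequence weakly null.\<close>

subsection \<open>The Hahn-Banach theorem\<close>

text \<open>Weak nullness is what makes the operator on l^1 weakly compact. For a merely bounded
  sequence x_n the pairing of a with f(x_n) need not be coordinatewise continuous on the unit ball:
  for a constant sequence the unit vectors tend to 0 while the pairing does not. If f(x_n) tends to
  0, the pairing is a uniform limit of finite sums. In the converse direction the obstacle is that
  the weak topology need not be metrizable, so compactness yields cluster points but not directly
  subsequences. Separating the cluster points needs Hahn-Banach, and the boundedness of weakly
  compact sets needs uniform boundedness. Hahn-Banach is reached through minimality: instead of
  extending a functional step by step, a sublinear bound is lowered until it can go no lower, and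
  then it is linear. Passing from (2) to (3) is not plain instantiation: l^1 has the points
  \<open>nat \<Rightarrow> real\<close>, whereas (2) ranges over structures on a sum type, so l^1 is
  first copied into that type.\<close>

definition sublinear :: "('a::real_vector \<Rightarrow> real) \<Rightarrow> bool"
  where "sublinear p \<longleftrightarrow> (\<forall>x y. p (x + y) \<le> p x + p y) \<and> (\<forall>c\<ge>0. \<forall>x. p (c *\<^sub>R x) = c * p x)"

text \<open>An inequality for positive \<open>c\<close> suffices, since the same inequality for
  \<open>inverse c\<close> at the scaled point is its converse.\<close>

lemma sublinearI:
  assumes add: "\<And>x y. p (x + y) \<le> p x + p y"
    and zero: "p 0 = 0"
    and scale: "\<And>c x. c > 0 \<Longrightarrow> p (c *\<^sub>R x) \<le> c * p x"
  shows "sublinear p"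
  unfolding sublinear_def
proof (intro conjI allI impI)
  fix c :: real and x
  assume "0 \<le> c"
  show "p (c *\<^sub>R x) = c * p x"
  proof (cases "c = 0")
    case False
    with \<open>0 \<le> c\<close> have c: "c > 0" by simp
    have "p x = p (inverse c *\<^sub>R (c *\<^sub>R x))" using c by simp
    also have "\<dots> \<le> inverse c * p (c *\<^sub>R x)" using c by (intro scale) simp
    finally have "c * p x \<le> p (c *\<^sub>R x)" using c by (simp add: field_simps)
    with scale[OF c, of x] show ?thesis by simp
  qed (simp add: zero)
qed (rule add)

lemma sublinear_add: "sublinear p \<Longrightarrow> p (x + y) \<le> p x + p y"
  and sublinear_scale: "sublinear p \<Longrightarrow> 0 \<le> c \<Longrightarrow> p (c *\<^sub>R x) = c * p x"
  by (auto simp: sublinear_def)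

lemma sublinear_zero: "sublinear p \<Longrightarrow> p 0 = 0"
  using sublinear_scale[of p 0 0] by simp

lemma sublinear_minus: "sublinear p \<Longrightarrow> - p (- x) \<le> p x"
  using sublinear_add[of p x "- x"] sublinear_zero[of p] by simp

text \<open>This is the one device for lowering a sublinear functional, used twice: to show that a
  minimal one is odd, and to prescribe the value of the final functional at a given point. The
  parameter t = 1 in the infimum produces the bound at \<open>- y\<close>, and t = 0 gives
  \<open>r \<le> q\<close>.\<close>

lemma sublinear_shrink:
  assumes q: "sublinear q"
  obtains r where "sublinear r" "r \<le> q" "r (- y) \<le> - q y"
proof
  define r where "r = (\<lambda>z. INF t\<in>{0..}. q (z + t *\<^sub>R y) - t * q y)"
  \<comment> \<open>The infimum is finite because \<open>t * q y\<close> is the value of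
    \<open>q\<close> at t y, which is (z + t y) + (- z).\<close>
  have low: "- q (- z) \<le> q (z + t *\<^sub>R y) - t * q y" if "0 \<le> t" for t z
    using sublinear_add[OF q, of "z + t *\<^sub>R y" "- z"] sublinear_scale[OF q that, of y] by simp
  have bdd: "bdd_below ((\<lambda>t. q (z + t *\<^sub>R y) - t * q y) ` {0..})" for z
    using low by (intro bdd_belowI2) auto
  have le: "r z \<le> q (z + t *\<^sub>R y) - t * q y" if "0 \<le> t" for z t
    unfolding r_def using that by (intro cINF_lower bdd) auto
  have ge: "b \<le> r z" if "\<And>t. 0 \<le> t \<Longrightarrow> b \<le> q (z + t *\<^sub>R y) - t * q y" for b z
    unfolding r_def using that by (intro cINF_greatest) auto
  show "r \<le> q"
    using le[of 0] by (auto simp: le_fun_def)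
  show "r (- y) \<le> - q y"
    using le[of 1 "- y"] sublinear_zero[OF q] by simp
  show "sublinear r"
  proof (rule sublinearI)
    fix v w
    have *: "r (v + w) \<le> (q (v + s *\<^sub>R y) - s * q y) + (q (w + t *\<^sub>R y) - t * q y)"
      if "0 \<le> s" "0 \<le> t" for s t
      using le[of "s + t" "v + w"] that sublinear_add[OF q, of "v + s *\<^sub>R y" "w + t *\<^sub>R y"]
      by (simp add: algebra_simps)
    have "r (v + w) - (q (v + s *\<^sub>R y) - s * q y) \<le> r w" if "0 \<le> s" for s
      by (rule ge) (use *[OF that] in \<open>simp add: algebra_simps\<close>)
    then have "r (v + w) - r w \<le> r v"
      by (intro ge) (simp add: algebra_simps)
    then show "r (v + w) \<le> r v + r w" by simp
  next
    have "r 0 \<le> 0" using le[of 0 0] sublinear_zero[OF q] by simp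
    moreover have "0 \<le> r 0" by (rule ge) (simp add: sublinear_scale[OF q])
    ultimately show "r 0 = 0" by simp
  next
    fix c :: real and x assume c: "c > 0"
    have "r (c *\<^sub>R x) / c \<le> r x"
    proof (rule ge)
      fix t :: real assume t: "0 \<le> t"
      have "r (c *\<^sub>R x) \<le> q (c *\<^sub>R x + (c * t) *\<^sub>R y) - (c * t) * q y"
        using c t by (intro le) simp
      also have "c *\<^sub>R x + (c * t) *\<^sub>R y = c *\<^sub>R (x + t *\<^sub>R y)"
        by (simp add: scaleR_add_right)
      finally show "r (c *\<^sub>R x) / c \<le> q (x + t *\<^sub>R y) - t * q y"
        using c sublinear_scale[OF q, of c "x + t *\<^sub>R y"] by (simp add: field_simps)
    qed
    then show "r (c *\<^sub>R x) \<le> c * r x" using c by (simp add: field_simps)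
  qed
qed

text \<open>The infimum is taken pointwise; the values \<open>- p (- x)\<close> bound it from below.
  Subadditivity needs the chain: given one member for each summand, the smaller of the two serves
  for both.\<close>

lemma sublinear_chain_INF:
  assumes ne: "C \<noteq> {}" and sub: "\<And>q. q \<in> C \<Longrightarrow> sublinear q" and p: "sublinear p"
    and le_p: "\<And>q. q \<in> C \<Longrightarrow> q \<le> p"
    and chain: "\<And>q r. q \<in> C \<Longrightarrow> r \<in> C \<Longrightarrow> q \<le> r \<or> r \<le> q"
  obtains u where "sublinear u" "\<And>q. q \<in> C \<Longrightarrow> u \<le> q"
proof
  define u where "u = (\<lambda>x. INF q\<in>C. q x)"
  have low: "- p (- x) \<le> q x" if "q \<in> C" for q x
    using sublinear_minus[OF sub[OF that], of x] le_p[OF that]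
    by (meson le_funD neg_le_iff_le order_trans)
  have bdd: "bdd_below ((\<lambda>q. q x) ` C)" for x
    using low by (intro bdd_belowI2) auto
  have le: "u x \<le> q x" if "q \<in> C" for q x
    unfolding u_def using that by (intro cINF_lower bdd)
  have ge: "b \<le> u x" if "\<And>q. q \<in> C \<Longrightarrow> b \<le> q x" for b x
    unfolding u_def using that ne by (intro cINF_greatest) auto
  show "u \<le> q" if "q \<in> C" for q
    using le[OF that] by (simp add: le_fun_def)
  show "sublinear u"
  proof (rule sublinearI)
    fix v w
    have *: "u (v + w) \<le> q v + r w" if "q \<in> C" "r \<in> C" for q r
      using chain[OF that]
    proof
      assume "q \<le> r"
      then have "q v + q w \<le> q v + r w" by (simp add: le_fun_def)
      with le[OF that(1), of "v + w"] sublinear_add[OF sub[OF that(1)], of v w] show ?thesis by simp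
    next
      assume "r \<le> q"
      then have "r v + r w \<le> q v + r w" by (simp add: le_fun_def)
      with le[OF that(2), of "v + w"] sublinear_add[OF sub[OF that(2)], of v w] show ?thesis by simp
    qed
    have "u (v + w) - q v \<le> u w" if "q \<in> C" for q
      by (rule ge) (use *[OF that] in \<open>simp add: algebra_simps\<close>)
    then have "u (v + w) - u w \<le> u v"
      by (intro ge) (simp add: algebra_simps)
    then show "u (v + w) \<le> u v + u w" by simp
  next
    show "u 0 = 0"
      unfolding u_def using ne by (simp add: sublinear_zero[OF sub] cong: INF_cong_simp)
  next
    fix c :: real and x assume c: "c > 0"
    have "u (c *\<^sub>R x) / c \<le> u x"
    proof (rule ge)
      fix q assume "q \<in> C"
      from le[OF this, of "c *\<^sub>R x"] show "u (c *\<^sub>R x) / c \<le> q x"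
        using c sublinear_scale[OF sub[OF \<open>q \<in> C\<close>], of c x] by (simp add: field_simps)
    qed
    then show "u (c *\<^sub>R x) \<le> c * u x" using c by (simp add: field_simps)
  qed
qed

lemma sublinear_minimal:
  assumes p: "sublinear p"
  obtains q where "sublinear q" "q \<le> p" "\<And>r. sublinear r \<Longrightarrow> r \<le> q \<Longrightarrow> r = q"
proof -
  let ?A = "{q. sublinear q \<and> q \<le> p}"
  \<comment> \<open>Zorn's lemma for the reversed order, so that its maximal element is a minimal
    functional.\<close>
  have "\<exists>m\<in>?A. \<forall>a\<in>?A. m \<ge> a \<longrightarrow> a = m"
  proof (rule predicate_Zorn)
    show "partial_order_on ?A (relation_of (\<ge>) ?A)"
      by (auto intro!: partial_order_on_relation_ofI)
    fix C assume C: "C \<in> Chains (relation_of (\<ge>) ?A)"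
    show "\<exists>u\<in>?A. \<forall>a\<in>C. u \<le> a"
    proof (cases "C = {}")
      case False
      have "\<And>q. q \<in> C \<Longrightarrow> q \<in> ?A" "\<And>q r. q \<in> C \<Longrightarrow> r \<in> C \<Longrightarrow> q \<le> r \<or> r \<le> q"
        using C by (auto simp: Chains_def relation_of_def)
      then obtain u where "sublinear u" "\<And>q. q \<in> C \<Longrightarrow> u \<le> q"
        using sublinear_chain_INF[OF False _ p] by (metis (no_types, lifting) mem_Collect_eq)
      moreover have "u \<le> p"
        using False calculation(2) \<open>\<And>q. q \<in> C \<Longrightarrow> q \<in> ?A\<close> by fastforce
      ultimately show ?thesis by blast
    qed (use p in auto)
  qed
  then show thesis using that by (metis (no_types, lifting) mem_Collect_eq order_trans)
qed

text \<open>Shrinking along \<open>y\<close> cannot change a minimal \<open>q\<close>, so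
  \<open>q (- y) \<le> - q y\<close> and \<open>q\<close> is odd. For an odd functional,
  subadditivity at the negated arguments is superadditivity.\<close>

lemma minimal_sublinear_linear:
  assumes q: "sublinear q" and min: "\<And>r. sublinear r \<Longrightarrow> r \<le> q \<Longrightarrow> r = q"
  shows "linear q"
proof -
  have neg: "q (- y) = - q y" for y
  proof -
    obtain r where "sublinear r" "r \<le> q" "r (- y) \<le> - q y"
      using sublinear_shrink[OF q] .
    with min have "q (- y) \<le> - q y" by metis
    with sublinear_minus[OF q, of y] show ?thesis by simp
  qed
  show ?thesis
  proof (rule linearI)
    fix x y
    show "q (x + y) = q x + q y"
      using sublinear_add[OF q, of x y] sublinear_add[OF q, of "- x" "- y"] neg[of x] neg[of y]
        neg[of "x + y"] by simp
  next
    fix c :: real and x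
    show "q (c *\<^sub>R x) = c *\<^sub>R q x"
    proof (cases "0 \<le> c")
      case False
      then have "q ((- c) *\<^sub>R (- x)) = (- c) * q (- x)" by (intro sublinear_scale[OF q]) simp
      then show ?thesis using neg[of x] by simp
    qed (simp add: sublinear_scale[OF q])
  qed
qed

theorem hahn_banach_sublinear:
  assumes p: "sublinear p"
  obtains f where "linear f" "\<And>x. f x \<le> p x" "f z = p z"
proof -
  \<comment> \<open>Shrinking along \<open>z\<close> before minimizing forces every sublinear
    functional below \<open>r\<close> to be at most \<open>- p z\<close> at \<open>- z\<close>, so a
    linear one is at least \<open>p z\<close> at \<open>z\<close>.\<close>
  obtain r where r: "sublinear r" "r \<le> p" "r (- z) \<le> - p z"
    using sublinear_shrink[OF p] .
  obtain q where q: "sublinear q" "q \<le> r" and min: "\<And>s. sublinear s \<Longrightarrow> s \<le> q \<Longrightarrow> s = q"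
    using sublinear_minimal[OF r(1)] by blast
  have lin: "linear q" using minimal_sublinear_linear[OF q(1) min] .
  have le: "q x \<le> p x" for x using q(2) r(2) by (meson le_funD order_trans)
  have "q (- z) \<le> - p z" using q(2) r(3) by (meson le_funD order_trans)
  with le[of z] have "q z = p z" using linear_neg[OF lin, of z] by simp
  with lin le show thesis by (rule that)
qed

lemma hahn_banach_blinfun:
  fixes p :: "'a::real_normed_vector \<Rightarrow> real"
  assumes p: "sublinear p" and le_norm: "\<And>x. p x \<le> norm x"
  obtains f :: "'a \<Rightarrow>\<^sub>L real" where "\<And>x. blinfun_apply f x \<le> p x" "blinfun_apply f z = p z"
    "\<And>x. \<bar>blinfun_apply f x\<bar> \<le> norm x"
proof -
  obtain f where lin: "linear f" and le: "\<And>x. f x \<le> p x" and z: "f z = p z"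
    using hahn_banach_sublinear[OF p] by blast
  have bound: "\<bar>f x\<bar> \<le> norm x" for x
    using le[of x] le_norm[of x] le[of "- x"] le_norm[of "- x"] linear_neg[OF lin, of x]
    by (auto simp: abs_le_iff)
  have "bounded_linear f"
    by (rule bounded_linear_intro[where K = 1])
      (use lin bound in \<open>auto simp: linear_add linear_scale\<close>)
  then show thesis
    by (intro that[of "Blinfun f"]) (simp_all add: bounded_linear_Blinfun_apply le z bound)
qed

lemma norming_functional:
  fixes z :: "'a::real_normed_vector"
  obtains f :: "'a \<Rightarrow>\<^sub>L real" where "blinfun_apply f z = norm z" "\<And>x. \<bar>blinfun_apply f x\<bar> \<le> norm x"
proof -
  have "sublinear (norm :: 'a \<Rightarrow> real)"
    by (auto simp: sublinear_def norm_triangle_ineq)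
  then show thesis by (rule hahn_banach_blinfun) (auto intro: that)
qed

text \<open>The distance to \<open>Y\<close> serves as the sublinear bound: it vanishes on
  \<open>Y\<close>, is at most the norm because 0 lies in \<open>Y\<close>, and is positive at
  \<open>z\<close> because \<open>Y\<close> is closed. A linear functional below it that attains it
  at \<open>z\<close> is the one sought.\<close>

lemma functional_vanishing_on_closed_subspace:
  fixes Y :: "'a::real_normed_vector set"
  assumes Y: "subspace Y" "closed Y" and z: "z \<notin> Y"
  obtains f :: "'a \<Rightarrow>\<^sub>L real" where "\<And>y. y \<in> Y \<Longrightarrow> blinfun_apply f y = 0" "blinfun_apply f z \<noteq> 0"
proof -
  have ne: "Y \<noteq> {}" using subspace_0[OF Y(1)] by auto
  have near: "\<exists>y\<in>Y. norm (x - y) < infdist x Y + e" if "e > 0" for x e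
    using infdist_notempty[OF ne, of x] that ne cInf_lessD[of "dist x ` Y" "infdist x Y + e"]
    by (auto simp: dist_norm)
  have sub: "sublinear (\<lambda>x. infdist x Y)"
  proof (rule sublinearI)
    fix v w
    show "infdist (v + w) Y \<le> infdist v Y + infdist w Y"
    proof (rule field_le_epsilon)
      fix e :: real assume "e > 0"
      then obtain a b where ab: "a \<in> Y" "b \<in> Y"
        "norm (v - a) < infdist v Y + e / 2" "norm (w - b) < infdist w Y + e / 2"
        using near[of "e / 2"] by (metis half_gt_zero)
      have "infdist (v + w) Y \<le> dist (v + w) (a + b)"
        using ab subspace_add[OF Y(1)] by (intro infdist_le) auto
      also have "\<dots> \<le> norm (v - a) + norm (w - b)"
        by (simp add: dist_norm norm_diff_triangle_ineq)
      finally show "infdist (v + w) Y \<le> infdist v Y + infdist w Y + e" using ab by simp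
    qed
  next
    show "infdist 0 Y = 0" using subspace_0[OF Y(1)] by simp
  next
    fix c :: real and x assume c: "c > 0"
    show "infdist (c *\<^sub>R x) Y \<le> c * infdist x Y"
    proof (rule field_le_epsilon)
      fix e :: real assume "e > 0"
      then obtain a where a: "a \<in> Y" "norm (x - a) < infdist x Y + e / c"
        using near[of "e / c" x] c by auto
      have "infdist (c *\<^sub>R x) Y \<le> dist (c *\<^sub>R x) (c *\<^sub>R a)"
        using a subspace_scale[OF Y(1)] by (intro infdist_le) auto
      also have "\<dots> = c * norm (x - a)"
        using c by (simp add: dist_norm flip: scaleR_diff_right)
      also have "\<dots> \<le> c * (infdist x Y + e / c)"
        using a c by (intro mult_left_mono) auto
      finally show "infdist (c *\<^sub>R x) Y \<le> c * infdist x Y + e"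
        using c by (simp add: algebra_simps)
    qed
  qed
  have norm: "infdist x Y \<le> norm x" for x
    using infdist_le[OF subspace_0[OF Y(1)], of x] by simp
  obtain f :: "'a \<Rightarrow>\<^sub>L real" where f: "\<And>x. blinfun_apply f x \<le> infdist x Y"
    "blinfun_apply f z = infdist z Y"
    using hahn_banach_blinfun[OF sub norm] by blast
  show thesis
  proof
    fix y assume "y \<in> Y"
    with f(1)[of y] f(1)[of "- y"] subspace_neg[OF Y(1) this] show "blinfun_apply f y = 0"
      by (simp add: blinfun.minus_right)
  next
    show "blinfun_apply f z \<noteq> 0"
      using f(2) infdist_pos_not_in_closed[OF Y(2) ne z] by simp
  qed
qed

subsection \<open>Uniform boundedness\<close>

text \<open>The closed sets \<open>A n\<close> cover the space, so by Baire one of them contains a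
  ball. A vector short enough to fit in the ball is the difference of two of its points, which is
  where the factor 2 comes from.\<close>

theorem uniform_boundedness_principle:
  fixes F :: "('a::banach \<Rightarrow>\<^sub>L 'b::real_normed_vector) set"
  assumes "\<And>x. bounded ((\<lambda>f. blinfun_apply f x) ` F)"
  shows "bounded F"
proof -
  define A where "A n = {x. \<forall>f\<in>F. norm (blinfun_apply f x) \<le> real n}" for n
  have closed: "closed (A n)" for n
  proof -
    have "A n = (\<Inter>f\<in>F. {x. norm (blinfun_apply f x) \<le> real n})" by (auto simp: A_def)
    then show ?thesis by (auto intro!: closed_INT closed_Collect_le continuous_intros)
  qed
  have cover: "(\<Union>n. A n) = UNIV"
  proof -
    have "\<exists>n. x \<in> A n" for x
    proof -
      obtain B where "\<And>f. f \<in> F \<Longrightarrow> norm (blinfun_apply f x) \<le> B"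
        using assms[of x] by (auto simp: bounded_iff)
      with real_arch_simple[of B] show ?thesis
        by (auto simp: A_def intro: order_trans)
    qed
    then show ?thesis by blast
  qed
  have "\<exists>n. interior (A n) \<noteq> {}"
  proof (rule ccontr)
    assume "\<nexists>n. interior (A n) \<noteq> {}"
    then have "euclidean interior_of (\<Union>n. A n) = {}"
      by (intro Baire_category_alt) (auto simp: completely_metrizable_space_euclidean closed)
    then show False unfolding cover by simp
  qed
  then obtain n x r where r: "r > 0" "cball x r \<subseteq> A n"
    by (metis ex_in_conv mem_interior_cball)
  have "norm f \<le> 2 * real n / r" if "f \<in> F" for f
  proof (rule norm_blinfun_bound)
    fix y
    show "norm (blinfun_apply f y) \<le> 2 * real n / r * norm y"
    proof (cases "y = 0")
      case False
      define c where "c = r / norm y"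
      have c: "c > 0" using r False by (simp add: c_def)
      have "x + c *\<^sub>R y \<in> cball x r" "x \<in> cball x r"
        using r False by (auto simp: dist_norm c_def)
      then have "norm (blinfun_apply f (x + c *\<^sub>R y)) \<le> n" "norm (blinfun_apply f x) \<le> n"
        using subsetD[OF r(2)] that by (auto simp: A_def)
      moreover have "c *\<^sub>R blinfun_apply f y = blinfun_apply f (x + c *\<^sub>R y) - blinfun_apply f x"
        by (simp add: blinfun.add_right blinfun.scaleR_right)
      ultimately have "norm (c *\<^sub>R blinfun_apply f y) \<le> 2 * real n"
        using norm_triangle_ineq4[of "blinfun_apply f (x + c *\<^sub>R y)" "blinfun_apply f x"] by simp
      then have "c * norm (blinfun_apply f y) \<le> 2 * real n" using c by simp
      then show ?thesis using r False by (simp add: c_def field_simps)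
    qed simp
  qed (use r in simp)
  then show ?thesis by (auto simp: bounded_iff)
qed

text \<open>Points become evaluation functionals on the dual, which is complete even if the space is
  not, so uniform boundedness applies there. Norming functionals bring the bound back to the points
  themselves.\<close>

lemma weakly_bounded_imp_bounded:
  fixes A :: "'a::real_normed_vector set"
  assumes "\<And>f :: 'a \<Rightarrow>\<^sub>L real. bounded (blinfun_apply f ` A)"
  shows "bounded A"
proof -
  define ev :: "'a \<Rightarrow> ('a \<Rightarrow>\<^sub>L real) \<Rightarrow>\<^sub>L real" where "ev x = Blinfun (\<lambda>f. blinfun_apply f x)" for x
  have ev: "blinfun_apply (ev x) f = blinfun_apply f x" for x f
    unfolding ev_def by (simp add: bounded_linear_Blinfun_apply blinfun.bounded_linear_left)
  have "bounded (ev ` A)"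
    using assms by (intro uniform_boundedness_principle) (simp add: image_image ev)
  then obtain B where B: "\<And>x. x \<in> A \<Longrightarrow> norm (ev x) \<le> B" by (auto simp: bounded_iff)
  have "norm x \<le> B" if x: "x \<in> A" for x
  proof -
    obtain f :: "'a \<Rightarrow>\<^sub>L real" where f: "blinfun_apply f x = norm x" "\<And>y. \<bar>blinfun_apply f y\<bar> \<le> norm y"
      using norming_functional[of x] by blast
    have "norm f \<le> 1" using f(2) by (intro norm_blinfun_bound) auto
    have "norm x = norm (blinfun_apply (ev x) f)" by (simp add: ev f)
    also have "\<dots> \<le> norm (ev x) * norm f" by (rule norm_blinfun)
    also have "\<dots> \<le> norm (ev x)" using \<open>norm f \<le> 1\<close> by (simp add: mult_left_le)
    finally show ?thesis using B[OF x] by simp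
  qed
  then show ?thesis by (auto simp: bounded_iff)
qed

subsection \<open>Weak and weak* convergence\<close>

lemma limitin_pullback_topology:
  "limitin (pullback_topology UNIV f T) x l F \<longleftrightarrow> limitin T (f \<circ> x) (f l) F"
proof
  assume *: "limitin (pullback_topology UNIV f T) x l F"
  show "limitin T (f \<circ> x) (f l) F"
    unfolding limitin_def
  proof (intro conjI allI impI)
    show "f l \<in> topspace T"
      using * by (simp add: limitin_def topspace_pullback_topology)
    fix U assume U: "openin T U \<and> f l \<in> U"
    then have "openin (pullback_topology UNIV f T) (f -` U)"
      by (auto simp: openin_pullback_topology)
    moreover have "\<forall>V. openin (pullback_topology UNIV f T) V \<and> l \<in> V \<longrightarrow> (\<forall>\<^sub>F n in F. x n \<in> V)"
      using * by (simp add: limitin_def)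
    ultimately have "\<forall>\<^sub>F n in F. x n \<in> f -` U" using U by blast
    then show "\<forall>\<^sub>F n in F. (f \<circ> x) n \<in> U" by simp
  qed
next
  assume "limitin T (f \<circ> x) (f l) F"
  then show "limitin (pullback_topology UNIV f T) x l F"
    by (auto simp: limitin_def topspace_pullback_topology openin_pullback_topology)
qed

lemma limitin_euclidean_fun_iff:
  fixes g :: "'b \<Rightarrow> 'i \<Rightarrow> 'c::topological_space"
  shows "limitin euclidean g l F \<longleftrightarrow> (\<forall>i. ((\<lambda>n. g n i) \<longlongrightarrow> l i) F)"
  by (subst euclidean_product_topology[symmetric]) (simp add: limitin_componentwise)

lemma limitin_weak_topology_iff:
  fixes l :: "'a::real_normed_vector"
  shows "limitin weak_topology x l F \<longleftrightarrow>
    (\<forall>f :: 'a \<Rightarrow>\<^sub>L real. ((\<lambda>n. blinfun_apply f (x n)) \<longlongrightarrow> blinfun_apply f l) F)"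
  unfolding weak_topology_def limitin_pullback_topology limitin_euclidean_fun_iff by simp

lemma weakly_null_iff:
  fixes x :: "nat \<Rightarrow> 'a::real_normed_vector"
  shows "weakly_null x \<longleftrightarrow> (\<forall>f :: 'a \<Rightarrow>\<^sub>L real. (\<lambda>n. blinfun_apply f (x n)) \<longlonglongrightarrow> 0)"
  by (simp add: weakly_null_def limitin_weak_topology_iff)

lemma weak_star_null_iff:
  "weak_star_null f \<longleftrightarrow> (\<forall>x. (\<lambda>n. blinfun_apply (f n) x) \<longlonglongrightarrow> 0)"
  unfolding weak_star_null_def strong_operator_topology_def limitin_pullback_topology
    limitin_euclidean_fun_iff by simp

lemma weak_star_null_subseq:
  "weak_star_null f \<Longrightarrow> strict_mono r \<Longrightarrow> weak_star_null (f \<circ> r)"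
  unfolding weak_star_null_iff
proof
  fix x
  assume "\<forall>x. (\<lambda>n. blinfun_apply (f n) x) \<longlonglongrightarrow> 0" "strict_mono r"
  from LIMSEQ_subseq_LIMSEQ[OF spec[OF this(1), of x] this(2)]
  show "(\<lambda>n. blinfun_apply ((f \<circ> r) n) x) \<longlonglongrightarrow> 0" by (simp add: o_def)
qed

lemma disjoint_dual_seq_subseq:
  "disjoint_dual_seq f \<Longrightarrow> strict_mono r \<Longrightarrow> disjoint_dual_seq (f \<circ> r)"
  by (auto simp: disjoint_dual_seq_def strict_mono_eq)

lemma topspace_weak_topology [simp]: "topspace weak_topology = UNIV"
  by (simp add: weak_topology_def topspace_pullback_topology)

lemma continuous_map_weak_topology:
  "continuous_map weak_topology euclideanreal (blinfun_apply f)"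
proof -
  have "continuous_map (weak_topology :: 'a topology) euclideanreal
      ((\<lambda>h. h f) \<circ> (\<lambda>x (f :: 'a \<Rightarrow>\<^sub>L real). blinfun_apply f x))"
    unfolding weak_topology_def by (intro continuous_map_pullback) simp
  then show ?thesis by (simp add: o_def)
qed

lemma continuous_map_into_weak_topology:
  fixes g :: "'a \<Rightarrow> 'b::real_normed_vector"
  assumes "\<And>f :: 'b \<Rightarrow>\<^sub>L real. continuous_map T euclideanreal (\<lambda>x. blinfun_apply f (g x))"
  shows "continuous_map T weak_topology g"
  unfolding weak_topology_def
proof (rule continuous_map_pullback')
  show "continuous_map T euclidean ((\<lambda>x (f :: 'b \<Rightarrow>\<^sub>L real). blinfun_apply f x) \<circ> g)"
    by (subst euclidean_product_topology[symmetric])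
      (simp add: continuous_map_componentwise_UNIV assms)
qed simp

text \<open>Needed to know that weakly compact sets are weakly closed. A norming functional of
  \<open>x - y\<close> tells the two points apart.\<close>

lemma Hausdorff_weak_topology: "Hausdorff_space (weak_topology :: 'a::real_normed_vector topology)"
  unfolding Hausdorff_space_def
proof (intro allI impI)
  fix x y :: 'a
  assume xy: "x \<in> topspace weak_topology \<and> y \<in> topspace weak_topology \<and> x \<noteq> y"
  obtain f :: "'a \<Rightarrow>\<^sub>L real" where "blinfun_apply f (x - y) = norm (x - y)"
    using norming_functional by blast
  with xy have neq: "blinfun_apply f x \<noteq> blinfun_apply f y" by (auto simp: blinfun.diff_right)
  obtain U V where UV: "open U" "open V" "blinfun_apply f x \<in> U" "blinfun_apply f y \<in> V"
    "U \<inter> V = {}" using hausdorff[OF neq] by metis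
  have pre: "openin weak_topology (blinfun_apply f -` W)" if "open W" for W
    using openin_continuous_map_preimage[OF continuous_map_weak_topology[of f], of W] that
    by (simp add: vimage_def)
  show "\<exists>U V. openin weak_topology U \<and> openin weak_topology V \<and> x \<in> U \<and> y \<in> V \<and> disjnt U V"
    using pre[OF UV(1)] pre[OF UV(2)] UV(3-)
    by (intro exI[of _ "blinfun_apply f -` U"] exI[of _ "blinfun_apply f -` V"])
      (auto simp: disjnt_def)
qed

lemma weakly_compact_imp_bounded:
  fixes K :: "'a::real_normed_vector set"
  assumes "compactin weak_topology K"
  shows "bounded K"
proof (rule weakly_bounded_imp_bounded)
  fix f :: "'a \<Rightarrow>\<^sub>L real"
  show "bounded (blinfun_apply f ` K)"
    using image_compactin[OF assms continuous_map_weak_topology[of f]]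
    by (simp add: compact_imp_bounded)
qed

lemma weakly_null_imp_bounded:
  fixes x :: "nat \<Rightarrow> 'a::real_normed_vector"
  assumes "weakly_null x"
  shows "bounded (range x)"
proof (rule weakly_bounded_imp_bounded)
  fix f :: "'a \<Rightarrow>\<^sub>L real"
  have "convergent (\<lambda>n. blinfun_apply f (x n))"
    using assms by (auto simp: weakly_null_iff convergent_def)
  then show "bounded (blinfun_apply f ` range x)"
    using convergent_imp_bounded[of "\<lambda>n. blinfun_apply f (x n)"]
    by (auto simp: image_image convergent_def)
qed

subsection \<open>Relative weak compactness gives weakly convergent subsequences\<close>

text \<open>Otherwise every point of \<open>K\<close> has a neighbourhood visited for only finitely
  many indices in \<open>I\<close>, and finitely many of these cover \<open>K\<close>. The index set
  is a parameter because the lemma is applied both to a whole sequence and to the indices at which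
  it leaves a neighbourhood.\<close>

lemma compactin_cluster_point:
  assumes K: "compactin X K" and I: "infinite I" and w: "\<And>k :: nat. k \<in> I \<Longrightarrow> w k \<in> K"
  obtains z where "z \<in> K" "\<And>U. openin X U \<Longrightarrow> z \<in> U \<Longrightarrow> infinite {k \<in> I. w k \<in> U}"
proof -
  have "\<exists>z\<in>K. \<forall>U. openin X U \<longrightarrow> z \<in> U \<longrightarrow> infinite {k \<in> I. w k \<in> U}"
  proof (rule ccontr)
    assume "\<not> ?thesis"
    then obtain U where U: "\<And>z. z \<in> K \<Longrightarrow> openin X (U z)" "\<And>z. z \<in> K \<Longrightarrow> z \<in> U z"
      "\<And>z. z \<in> K \<Longrightarrow> finite {k \<in> I. w k \<in> U z}"
      by metis
    have "\<exists>\<F>. finite \<F> \<and> \<F> \<subseteq> U ` K \<and> K \<subseteq> \<Union>\<F>"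
      using U by (intro compactinD[OF K]) auto
    then obtain F where F: "finite F" "F \<subseteq> K" "K \<subseteq> \<Union> (U ` F)"
      by (metis finite_subset_image)
    have "I \<subseteq> (\<Union>z\<in>F. {k \<in> I. w k \<in> U z})" using w F(3) by fastforce
    moreover have "finite (\<Union>z\<in>F. {k \<in> I. w k \<in> U z})" using F U(3) by auto
    ultimately show False using I finite_subset by blast
  qed
  then show thesis using that by blast
qed

text \<open>Disjoint neighbourhoods of \<open>h z\<close> and \<open>c\<close> would be visited
  infinitely often and almost always, respectively. So convergence of a functional along a sequence
  fixes its value at every cluster point.\<close>

lemma cluster_value_of_convergent:
  fixes h :: "'a \<Rightarrow> real"
  assumes h: "continuous_map X euclideanreal h" and lim: "(\<lambda>k. h (w k)) \<longlonglongrightarrow> c"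
    and z: "z \<in> topspace X" and cl: "\<And>U. openin X U \<Longrightarrow> z \<in> U \<Longrightarrow> infinite {k :: nat. w k \<in> U}"
  shows "h z = c"
proof (rule ccontr)
  assume neq: "h z \<noteq> c"
  obtain U V where UV: "open U" "open V" "h z \<in> U" "c \<in> V" "U \<inter> V = {}"
    using hausdorff[OF neq] by metis
  have "infinite {k. w k \<in> {x \<in> topspace X. h x \<in> U}}"
    using UV z openin_continuous_map_preimage[OF h, of U] by (intro cl) auto
  moreover have "eventually (\<lambda>k. h (w k) \<in> V) sequentially"
    using lim UV by (auto dest: topological_tendstoD)
  then have "finite {k. h (w k) \<notin> V}"
    by (simp add: eventually_cofinite flip: cofinite_eq_sequentially)
  then have "finite {k. w k \<in> {x \<in> topspace X. h x \<in> U}}"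
    by (rule rev_finite_subset) (use UV in auto)
  ultimately show False by simp
qed

text \<open>In place of a diagonal argument: a product of compact intervals is compact, and for a
  countable index type the product is first countable, hence sequentially compact.\<close>

lemma subseq_pointwise_convergent:
  fixes a :: "nat \<Rightarrow> 'i::countable \<Rightarrow> real"
  assumes "\<And>i. bounded (range (\<lambda>n. a n i))"
  obtains r :: "nat \<Rightarrow> nat" and l where "strict_mono r" "\<And>i. (\<lambda>k. a (r k) i) \<longlonglongrightarrow> l i"
proof -
  have "\<forall>i. \<exists>C. \<forall>n. \<bar>a n i\<bar> \<le> C"
    using assms by (simp add: bounded_iff)
  then obtain C where C: "\<And>i n. \<bar>a n i\<bar> \<le> C i" by metis
  let ?B = "PiE UNIV (\<lambda>i. {- C i..C i})"
  have "compactin (product_topology (\<lambda>_. euclideanreal) UNIV) ?B"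
    by (simp add: compactin_PiE)
  then have "compact ?B" by (simp add: euclidean_product_topology)
  then have "seq_compact ?B" by (rule compact_imp_seq_compact)
  moreover have "a n \<in> ?B" for n
    using C[of n] by (auto simp: abs_le_iff minus_le_iff)
  ultimately obtain l r where "strict_mono r" "(a \<circ> r) \<longlonglongrightarrow> l"
    using seq_compactE by metis
  moreover from this(2) have "(\<lambda>k. a (r k) i) \<longlonglongrightarrow> l i" for i
    using limitin_euclidean_fun_iff[of "a \<circ> r" l sequentially] by simp
  ultimately show thesis using that by blast
qed

text \<open>Finite rational combinations are indexed by lists so that the index type is countable;
  the separating functionals carry the same index.\<close>

definition rat_span :: "(nat \<Rightarrow> 'a::real_vector) \<Rightarrow> (rat \<times> nat) list \<Rightarrow> 'a"
  where "rat_span x l = (\<Sum>(q, i)\<leftarrow>l. of_rat q *\<^sub>R x i)"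

lemma rat_span_append: "rat_span x l + rat_span x m = rat_span x (l @ m)"
  by (simp add: rat_span_def)

lemma rat_span_scale: "of_rat c *\<^sub>R rat_span x l = rat_span x (map (\<lambda>(q, i). (c * q, i)) l)"
  by (induction l) (auto simp: rat_span_def scaleR_add_right of_rat_mult)

lemma rat_span_single: "x i = rat_span x [(1, i)]"
  by (simp add: rat_span_def)

text \<open>Real multiples are recovered in the closure by approximating the scalar and the vector
  simultaneously.\<close>

lemma subspace_closure_rat_span:
  fixes x :: "nat \<Rightarrow> 'a::real_normed_vector"
  shows "subspace (closure (range (rat_span x)))"
proof (rule subspaceI)
  have "0 = rat_span x []" by (simp add: rat_span_def)
  then show "0 \<in> closure (range (rat_span x))"
    using closure_subset by (metis rangeI subsetD)
next
  fix u v
  assume "u \<in> closure (range (rat_span x))" "v \<in> closure (range (rat_span x))"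
  then obtain s t where "\<And>n. s n \<in> range (rat_span x)" "s \<longlonglongrightarrow> u"
    "\<And>n. t n \<in> range (rat_span x)" "t \<longlonglongrightarrow> v"
    unfolding closure_sequential by blast
  moreover from this have "s n + t n \<in> range (rat_span x)" for n
    by (metis rat_span_append rangeE rangeI)
  ultimately show "u + v \<in> closure (range (rat_span x))"
    unfolding closure_sequential by (intro exI[of _ "\<lambda>n. s n + t n"]) (auto intro: tendsto_add)
next
  fix c :: real and u
  assume "u \<in> closure (range (rat_span x))"
  then obtain s where s: "\<And>n. s n \<in> range (rat_span x)" "s \<longlonglongrightarrow> u"
    unfolding closure_sequential by blast
  have "\<exists>q. \<bar>of_rat q - c\<bar> < 1 / real (Suc n)" for n
  proof -
    obtain q where "c - 1 / real (Suc n) < of_rat q" "of_rat q < c + 1 / real (Suc n)"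
      using of_rat_dense[of "c - 1 / real (Suc n)" "c + 1 / real (Suc n)"] by auto
    then show ?thesis by (intro exI[of _ q]) auto
  qed
  then obtain q where q: "\<And>n. \<bar>of_rat (q n) - c\<bar> < 1 / real (Suc n)" by metis
  have "(\<lambda>n. of_rat (q n)) \<longlonglongrightarrow> c"
    by (rule LIM_zero_cancel, rule Lim_null_comparison[OF _ LIMSEQ_inverse_real_of_nat])
      (use q in \<open>auto simp: inverse_eq_divide intro!: always_eventually less_imp_le\<close>)
  then have "(\<lambda>n. of_rat (q n) *\<^sub>R s n) \<longlonglongrightarrow> c *\<^sub>R u"
    using s(2) by (rule tendsto_scaleR)
  moreover have "of_rat (q n) *\<^sub>R s n \<in> range (rat_span x)" for n
    using s(1)[of n] by (auto simp: rat_span_scale)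
  ultimately show "c *\<^sub>R u \<in> closure (range (rat_span x))"
    unfolding closure_sequential by (intro exI[of _ "\<lambda>n. of_rat (q n) *\<^sub>R s n"]) auto
qed

text \<open>Take norming functionals of the dense points. If all of them vanish at a nonzero
  \<open>y\<close>, a dense point within half the norm of \<open>y\<close> has norm below that half
  too, so \<open>y\<close> would be shorter than itself.\<close>

lemma separating_sequence_of_functionals:
  fixes d :: "'i \<Rightarrow> 'a::real_normed_vector"
  obtains g :: "'i \<Rightarrow> ('a \<Rightarrow>\<^sub>L real)"
  where "\<And>y. y \<in> closure (range d) \<Longrightarrow> (\<And>i. blinfun_apply (g i) y = 0) \<Longrightarrow> y = 0"
proof -
  have "\<forall>i. \<exists>f :: 'a \<Rightarrow>\<^sub>L real. blinfun_apply f (d i) = norm (d i) \<and> (\<forall>x. \<bar>blinfun_apply f x\<bar> \<le> norm x)"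
    using norming_functional by metis
  then obtain g :: "'i \<Rightarrow> ('a \<Rightarrow>\<^sub>L real)" where g: "\<And>i. blinfun_apply (g i) (d i) = norm (d i)"
    "\<And>i x. \<bar>blinfun_apply (g i) x\<bar> \<le> norm x"
    by metis
  show thesis
  proof (rule that[of g], rule ccontr)
    fix y assume y: "y \<in> closure (range d)" "\<And>i. blinfun_apply (g i) y = 0" and "y \<noteq> 0"
    then obtain i where i: "dist (d i) y < norm y / 2"
      unfolding closure_approachable by (metis half_gt_zero imageE zero_less_norm_iff)
    have "norm (d i) = \<bar>blinfun_apply (g i) (d i - y)\<bar>"
      using g(1)[of i] y(2)[of i] by (simp add: blinfun.diff_right)
    also have "\<dots> < norm y / 2" using g(2)[of i "d i - y"] i by (simp add: dist_norm)
    finally have "norm (d i) + norm (y - d i) < norm y" using i by (simp add: dist_norm norm_minus_commute)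
    then show False using norm_triangle_ineq[of "d i" "y - d i"] by simp
  qed
qed

text \<open>Half of the Eberlein-Smulian theorem. Weak cluster points of the sequence lie in its closed
  linear span, which is separable, so countably many functionals tell them apart; along a
  subsequence on which all of these functionals converge there is a single cluster point.\<close>

theorem relatively_weakly_compact_subseq:
  fixes x :: "nat \<Rightarrow> 'a::real_normed_vector"
  assumes A: "relatively_weakly_compact A" and x: "\<And>n. x n \<in> A"
  obtains r :: "nat \<Rightarrow> nat" and z where "strict_mono r" "limitin weak_topology (x \<circ> r) z sequentially"
proof -
  define K where "K = weak_topology closure_of A"
  have K: "compactin weak_topology K" using A by (simp add: K_def relatively_weakly_compact_def)
  have xK: "x n \<in> K" for n
    using x closure_of_subset[of A weak_topology] by (auto simp: K_def)
  define Y where "Y = closure (range (rat_span x))"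
  have Y: "subspace Y" "closed Y" by (simp_all add: Y_def subspace_closure_rat_span)
  have xY: "x n \<in> Y" for n
    unfolding Y_def using rat_span_single[of x n] closure_subset by (metis rangeI subsetD)
  obtain g :: "(rat \<times> nat) list \<Rightarrow> ('a \<Rightarrow>\<^sub>L real)"
    where g: "\<And>y. y \<in> Y \<Longrightarrow> (\<And>i. blinfun_apply (g i) y = 0) \<Longrightarrow> y = 0"
    unfolding Y_def using separating_sequence_of_functionals[of "rat_span x"] by blast
  have "bounded (range (\<lambda>n. blinfun_apply (g i) (x n)))" for i
  proof -
    have "bounded (blinfun_apply (g i) ` K)"
      using weakly_compact_imp_bounded[OF K] by (rule bounded_linear_image) (rule blinfun.bounded_linear_right)
    then show ?thesis by (rule bounded_subset) (use xK in auto)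
  qed
  then obtain r l where r: "strict_mono r" "\<And>i. (\<lambda>k. blinfun_apply (g i) (x (r k))) \<longlonglongrightarrow> l i"
    using subseq_pointwise_convergent[of "\<lambda>n i. blinfun_apply (g i) (x n)"] by blast
  define w where "w = x \<circ> r"
  let ?cluster = "\<lambda>z. \<forall>U. openin weak_topology U \<longrightarrow> z \<in> U \<longrightarrow> infinite {k. w k \<in> U}"
  \<comment> \<open>A norm closed subspace also contains weak cluster points: a functional vanishing
    on \<open>Y\<close> is constantly 0 along \<open>w\<close>, hence 0 at \<open>z\<close>.\<close>
  have inY: "z \<in> Y" if "?cluster z" for z
  proof (rule ccontr)
    assume "z \<notin> Y"
    then obtain f :: "'a \<Rightarrow>\<^sub>L real" where f: "\<And>y. y \<in> Y \<Longrightarrow> blinfun_apply f y = 0" "blinfun_apply f z \<noteq> 0"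
      using functional_vanishing_on_closed_subspace[OF Y] by blast
    have "blinfun_apply f z = 0"
      by (rule cluster_value_of_convergent[OF continuous_map_weak_topology, of _ w])
        (use that f(1) xY in \<open>auto simp: w_def\<close>)
    with f(2) show False by simp
  qed
  have gl: "blinfun_apply (g i) z = l i" if "?cluster z" for z i
    by (rule cluster_value_of_convergent[OF continuous_map_weak_topology, of _ w])
      (use that r(2) in \<open>auto simp: w_def\<close>)
  have unique: "z = z'" if "?cluster z" "?cluster z'" for z z'
    using g[of "z - z'"] inY[OF that(1)] inY[OF that(2)] gl[OF that(1)] gl[OF that(2)]
      subspace_diff[OF Y(1)] by (simp add: blinfun.diff_right)
  have wK: "w k \<in> K" for k by (simp add: w_def xK)
  obtain z where "\<And>U. openin weak_topology U \<Longrightarrow> z \<in> U \<Longrightarrow> infinite {k \<in> UNIV. w k \<in> U}"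
    using compactin_cluster_point[OF K infinite_UNIV_nat, of w] wK by blast
  then have z: "?cluster z" by simp
  have "limitin weak_topology w z sequentially"
    unfolding limitin_def
  proof (intro conjI allI impI)
    fix U assume U: "openin weak_topology U \<and> z \<in> U"
    show "eventually (\<lambda>k. w k \<in> U) sequentially"
    proof (rule ccontr)
      assume "\<not> ?thesis"
      then have inf: "infinite {k. w k \<notin> U}"
        by (simp add: eventually_cofinite flip: cofinite_eq_sequentially)
      \<comment> \<open>Compactness gives a cluster point of the part of \<open>w\<close> outside
        \<open>U\<close>. It is a cluster point of all of \<open>w\<close>, hence equal to
        \<open>z\<close>, yet \<open>U\<close> is a neighbourhood of \<open>z\<close> which that
        part never meets.\<close>
      obtain z' where z': "\<And>V. openin weak_topology V \<Longrightarrow> z' \<in> V \<Longrightarrow> infinite {k \<in> {k. w k \<notin> U}. w k \<in> V}"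
        using compactin_cluster_point[OF K inf, of w] wK by blast
      have "?cluster z'"
        using z' by (metis (no_types, lifting) Collect_mono finite_subset mem_Collect_eq)
      with z have "z' = z" by (rule unique[symmetric])
      with z'[of U] U show False by auto
    qed
  qed simp
  with r(1) show thesis using that by (simp add: w_def)
qed

subsection \<open>The space of absolutely summable sequences\<close>

text \<open>Replaces a norm bound by conditions on finitely many coordinates each, which survive
  coordinatewise limits.\<close>

lemma summable_abs_iff_partial_sums_le:
  fixes a :: "nat \<Rightarrow> real"
  shows "(summable (\<lambda>n. \<bar>a n\<bar>) \<and> (\<Sum>n. \<bar>a n\<bar>) \<le> c) \<longleftrightarrow> (\<forall>k. (\<Sum>i<k. \<bar>a i\<bar>) \<le> c)"
proof
  assume *: "\<forall>k. (\<Sum>i<k. \<bar>a i\<bar>) \<le> c"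
  then have "summable (\<lambda>n. \<bar>a n\<bar>)"
    by (intro summableI_nonneg_bounded[where x = c]) auto
  with * show "summable (\<lambda>n. \<bar>a n\<bar>) \<and> (\<Sum>n. \<bar>a n\<bar>) \<le> c"
    by (auto intro: suminf_le_const)
qed (auto intro: order_trans[OF sum_le_suminf])

lemma unit_ball_ell1: "unit_ball ell1 = {a. \<forall>k. (\<Sum>i<k. \<bar>a i\<bar>) \<le> 1}"
  using summable_abs_iff_partial_sums_le[of _ 1] by (auto simp: unit_ball_def ell1_def)

lemma ell1_complete:
  fixes s :: "nat \<Rightarrow> nat \<Rightarrow> real"
  assumes sum: "\<And>n. summable (\<lambda>i. \<bar>s n i\<bar>)"
    and Cauchy: "\<And>e. e > 0 \<Longrightarrow> \<exists>N. \<forall>m\<ge>N. \<forall>n\<ge>N. (\<Sum>i. \<bar>s m i - s n i\<bar>) < e"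
  obtains x where "summable (\<lambda>i. \<bar>x i\<bar>)" "(\<lambda>n. \<Sum>i. \<bar>s n i - x i\<bar>) \<longlonglongrightarrow> 0"
proof -
  have sumd: "summable (\<lambda>i. \<bar>s m i - s n i\<bar>)" for m n
    by (rule summable_comparison_test[OF _ summable_add[OF sum[of m] sum[of n]]])
      (auto intro: abs_triangle_ineq4)
  have part: "(\<Sum>i<k. \<bar>s m i - s n i\<bar>) \<le> (\<Sum>i. \<bar>s m i - s n i\<bar>)" for m n k
    by (intro sum_le_suminf sumd) auto
  have "Cauchy (\<lambda>n. s n i)" for i
  proof (rule metric_CauchyI)
    fix e :: real assume "e > 0"
    then obtain N where N: "\<forall>m\<ge>N. \<forall>n\<ge>N. (\<Sum>i. \<bar>s m i - s n i\<bar>) < e" using Cauchy by blast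
    have "\<bar>s m i - s n i\<bar> \<le> (\<Sum>j<Suc i. \<bar>s m j - s n j\<bar>)" for m n
      by (simp add: sum_nonneg)
    with N part[where k = "Suc i"] show "\<exists>N. \<forall>m\<ge>N. \<forall>n\<ge>N. dist (s m i) (s n i) < e"
      unfolding dist_real_def by (meson order_le_less_trans)
  qed
  then have "\<forall>i. \<exists>l. (\<lambda>n. s n i) \<longlonglongrightarrow> l"
    by (simp add: Cauchy_convergent_iff convergent_def)
  then obtain x where x: "\<And>i. (\<lambda>n. s n i) \<longlonglongrightarrow> x i" by metis
  have near: "\<exists>N. \<forall>m\<ge>N. summable (\<lambda>i. \<bar>s m i - x i\<bar>) \<and> (\<Sum>i. \<bar>s m i - x i\<bar>) \<le> e" if e: "e > 0" for e
  proof -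
    obtain N where N: "\<forall>m\<ge>N. \<forall>n\<ge>N. (\<Sum>i. \<bar>s m i - s n i\<bar>) < e" using Cauchy[OF e] by blast
    \<comment> \<open>With \<open>k\<close> fixed only finitely many coordinates occur, so n may
      tend to infinity; the resulting bound does not depend on \<open>k\<close>.\<close>
    have "(\<Sum>i<k. \<bar>s m i - x i\<bar>) \<le> e" if m: "m \<ge> N" for m k
    proof (rule LIMSEQ_le_const2)
      show "(\<lambda>n. \<Sum>i<k. \<bar>s m i - s n i\<bar>) \<longlonglongrightarrow> (\<Sum>i<k. \<bar>s m i - x i\<bar>)"
        by (intro tendsto_intros x)
      show "\<exists>N. \<forall>n\<ge>N. (\<Sum>i<k. \<bar>s m i - s n i\<bar>) \<le> e"
        using N m part by (meson less_imp_le order_trans)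
    qed
    then have "summable (\<lambda>i. \<bar>s m i - x i\<bar>) \<and> (\<Sum>i. \<bar>s m i - x i\<bar>) \<le> e" if "m \<ge> N" for m
      using that summable_abs_iff_partial_sums_le[of "\<lambda>i. s m i - x i" e] by simp
    then show ?thesis by blast
  qed
  show thesis
  proof
    obtain N where "summable (\<lambda>i. \<bar>s N i - x i\<bar>)" using near[of 1] by auto
    then show "summable (\<lambda>i. \<bar>x i\<bar>)"
      by (rule summable_comparison_test[OF _ summable_add[OF sum[of N]], rotated]) auto
    show "(\<lambda>n. \<Sum>i. \<bar>s n i - x i\<bar>) \<longlonglongrightarrow> 0"
    proof (rule LIMSEQ_I)
      fix r :: real assume "r > 0"
      then obtain N where N: "\<forall>m\<ge>N. summable (\<lambda>i. \<bar>s m i - x i\<bar>) \<and> (\<Sum>i. \<bar>s m i - x i\<bar>) \<le> r / 2"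
        using near[of "r / 2"] by auto
      have "norm ((\<Sum>i. \<bar>s m i - x i\<bar>) - 0) < r" if "m \<ge> N" for m
      proof -
        have "0 \<le> (\<Sum>i. \<bar>s m i - x i\<bar>)" using N that by (intro suminf_nonneg) auto
        then show ?thesis using N that \<open>r > 0\<close> by fastforce
      qed
      then show "\<exists>N. \<forall>n\<ge>N. norm ((\<Sum>i. \<bar>s n i - x i\<bar>) - 0) < r" by blast
    qed
  qed
qed

lemma banach_space_ell1: "banach_space ell1"
proof
  fix s :: "nat \<Rightarrow> nat \<Rightarrow> real"
  assume s: "\<And>n. s n \<in> vcarrier ell1"
    and Cauchy: "\<And>e. e > 0 \<Longrightarrow> \<exists>N. \<forall>m\<ge>N. \<forall>n\<ge>N. vdist ell1 (s m) (s n) < e"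
  have sum: "summable (\<lambda>i. \<bar>s n i\<bar>)" for n
    using s[of n] by (simp add: ell1_def)
  have small: "\<exists>N. \<forall>m\<ge>N. \<forall>n\<ge>N. (\<Sum>i. \<bar>s m i - s n i\<bar>) < e" if "e > 0" for e
    using Cauchy[OF that] by (simp add: ell1_def vdist_def)
  obtain x where "summable (\<lambda>i. \<bar>x i\<bar>)" "(\<lambda>n. \<Sum>i. \<bar>s n i - x i\<bar>) \<longlonglongrightarrow> 0"
    using ell1_complete[OF sum small] .
  then show "\<exists>x\<in>vcarrier ell1. (\<lambda>n. vdist ell1 (s n) x) \<longlonglongrightarrow> 0"
    by (auto simp: ell1_def vdist_def)
next
  fix a b :: "nat \<Rightarrow> real"
  assume "a \<in> vcarrier ell1" "b \<in> vcarrier ell1"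
  then have ab: "summable (\<lambda>n. \<bar>a n\<bar>)" "summable (\<lambda>n. \<bar>b n\<bar>)" by (simp_all add: ell1_def)
  have sum: "summable (\<lambda>n. \<bar>a n + b n\<bar>)"
    by (rule summable_comparison_test[OF _ summable_add[OF ab]]) (auto intro: abs_triangle_ineq)
  then show "vadd ell1 a b \<in> vcarrier ell1" by (simp add: ell1_def)
  have "(\<Sum>n. \<bar>a n + b n\<bar>) \<le> (\<Sum>n. \<bar>a n\<bar> + \<bar>b n\<bar>)"
    by (intro suminf_le sum summable_add ab abs_triangle_ineq)
  then show "vnorm ell1 (vadd ell1 a b) \<le> vnorm ell1 a + vnorm ell1 b"
    using suminf_add[OF ab] by (simp add: ell1_def)
next
  fix a :: "nat \<Rightarrow> real"
  assume "a \<in> vcarrier ell1"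
  then have "summable (\<lambda>n. \<bar>a n\<bar>)" by (simp add: ell1_def)
  then show "(vnorm ell1 a = 0) = (a = vzero ell1)"
    by (auto simp: ell1_def suminf_eq_zero_iff)
qed (auto simp: ell1_def algebra_simps abs_mult suminf_mult)

text \<open>Serves to copy l^1 into the right summand of the sum type. Outside the range of
  \<open>h\<close> the values of \<open>inv h\<close> are arbitrary, which is harmless because the
  Banach space axioms speak only of carrier points.\<close>

definition transport_structure :: "('a \<Rightarrow> 'b) \<Rightarrow> 'a normed_structure \<Rightarrow> 'b normed_structure"
  where "transport_structure h Z =
    \<lparr>vcarrier = h ` vcarrier Z, vadd = (\<lambda>x y. h (vadd Z (inv h x) (inv h y))), vzero = h (vzero Z),
     vscale = (\<lambda>c x. h (vscale Z c (inv h x))), vnorm = (\<lambda>x. vnorm Z (inv h x))\<rparr>"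

lemma banach_space_transport:
  fixes h :: "'a \<Rightarrow> 'b"
  assumes "banach_space Z" and h: "inj h"
  shows "banach_space (transport_structure h Z)"
proof -
  interpret Z: banach_space Z by fact
  show ?thesis
  proof
    fix s :: "nat \<Rightarrow> 'b"
    assume s: "\<And>n. s n \<in> vcarrier (transport_structure h Z)"
      and *: "\<And>e. e > 0 \<Longrightarrow> \<exists>N. \<forall>m\<ge>N. \<forall>n\<ge>N. vdist (transport_structure h Z) (s m) (s n) < e"
    have "\<exists>t. t \<in> vcarrier Z \<and> s n = h t" for n
      using s[of n] by (auto simp: transport_structure_def)
    then obtain t where t: "\<And>n. t n \<in> vcarrier Z" "\<And>n. s n = h (t n)" by metis
    have dist: "vdist (transport_structure h Z) (h u) (h v) = vdist Z u v" for u v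
      by (simp add: vdist_def transport_structure_def inv_f_f[OF h])
    obtain y where "y \<in> vcarrier Z" "(\<lambda>n. vdist Z (t n) y) \<longlonglongrightarrow> 0"
      using Z.norm_complete[of t] t * by (auto simp: dist)
    then show "\<exists>x\<in>vcarrier (transport_structure h Z). (\<lambda>n. vdist (transport_structure h Z) (s n) x) \<longlonglongrightarrow> 0"
      by (intro bexI[of _ "h y"]) (simp_all add: t(2) dist, simp add: transport_structure_def)
  qed (auto simp: transport_structure_def inv_f_f[OF h] inj_eq[OF h] Z.zero_closed Z.add_closed
      Z.scale_closed Z.add_assoc Z.add_zero Z.add_minus Z.scale_add_right Z.scale_add_left
      Z.scale_scale Z.scale_one Z.norm_eq_zero Z.norm_scale Z.norm_triangle intro: Z.add_commute)
qed

lemma unit_ball_transport: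
  "inj h \<Longrightarrow> unit_ball (transport_structure h Z) = h ` unit_ball Z"
  by (auto simp: unit_ball_def transport_structure_def inv_f_f)

lemma bounded_operator_transport:
  "inj h \<Longrightarrow> bounded_operator (transport_structure h Z) (S \<circ> inv h) \<longleftrightarrow> bounded_operator Z S"
  by (simp add: bounded_operator_def transport_structure_def)

lemma image_unit_ball_transport:
  "inj h \<Longrightarrow> (S \<circ> inv h) ` unit_ball (transport_structure h Z) = S ` unit_ball Z"
  by (simp add: unit_ball_transport image_image)

lemma weakly_compact_operator_transport:
  "inj h \<Longrightarrow>
    weakly_compact_operator (transport_structure h Z) (S \<circ> inv h) \<longleftrightarrow> weakly_compact_operator Z S"
  by (simp only: weakly_compact_operator_def bounded_operator_transport image_unit_ball_transport)

lemma almost_limited_operator_transport: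
  "inj h \<Longrightarrow>
    almost_limited_operator (transport_structure h Z) (R \<circ> inv h) \<longleftrightarrow> almost_limited_operator Z R"
  by (simp only: almost_limited_operator_def bounded_operator_transport image_unit_ball_transport)

subsection \<open>The operator on \<open>\<ell>\<^sup>1\<close> given by a weakly null sequence\<close>

text \<open>Banach-Alaoglu for l^1 as the dual of c_0, with the coordinatewise topology: the ball is
  cut out of a product of intervals by closed conditions on partial sums.\<close>

lemma compact_unit_ball_ell1: "compact (unit_ball ell1)"
proof -
  let ?P = "PiE UNIV (\<lambda>_ :: nat. {- 1..1 :: real})"
  have "compactin (product_topology (\<lambda>_. euclideanreal) UNIV) ?P"
    by (simp add: compactin_PiE)
  then have "compact ?P" by (simp add: euclidean_product_topology)
  moreover have "closed (unit_ball ell1)"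
    unfolding unit_ball_ell1
    by (intro closed_Collect_all closed_Collect_le continuous_intros)
      (auto intro!: continuous_intros continuous_on_product_coordinates)
  moreover have "unit_ball ell1 \<subseteq> ?P"
  proof
    fix a :: "nat \<Rightarrow> real" assume a: "a \<in> unit_ball ell1"
    have "\<bar>a i\<bar> \<le> 1" for i
    proof -
      have "\<bar>a i\<bar> \<le> (\<Sum>j<Suc i. \<bar>a j\<bar>)" by (simp add: sum_nonneg)
      also have "\<dots> \<le> 1" using a unfolding unit_ball_ell1 by blast
      finally show ?thesis .
    qed
    then show "a \<in> ?P" by (auto simp: abs_le_iff minus_le_iff)
  qed
  ultimately show ?thesis
    using compact_Int_closed[of ?P "unit_ball ell1"] by (simp add: Int_absorb1)
qed

text \<open>Continuity refers to coordinatewise convergence (the topology of functions), not to the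
  \<open>\<ell>\<^sup>1\<close> norm.\<close>

lemma continuous_on_unit_ball_ell1_pairing:
  fixes c :: "nat \<Rightarrow> real"
  assumes c: "c \<longlonglongrightarrow> 0"
  shows "continuous_on (unit_ball ell1) (\<lambda>a. \<Sum>n. a n * c n)"
proof (rule uniform_limit_theorem)
  show "\<forall>\<^sub>F k in sequentially. continuous_on (unit_ball ell1) (\<lambda>a. \<Sum>i<k. a i * c i)"
    by (intro always_eventually allI continuous_intros)
      (auto intro: continuous_on_subset[OF continuous_on_product_coordinates])
  \<comment> \<open>The tail of \<open>a\<close> has l^1 norm at most 1, so the tail of the pairing
    is at most the bound on the later \<open>c n\<close>, uniformly in \<open>a\<close>.\<close>
  show "uniform_limit (unit_ball ell1) (\<lambda>k a. \<Sum>i<k. a i * c i) (\<lambda>a. \<Sum>n. a n * c n) sequentially"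
  proof (rule uniform_limitI)
    fix e :: real assume e: "e > 0"
    then obtain N where N: "\<And>n. n \<ge> N \<Longrightarrow> \<bar>c n\<bar> < e / 2"
      using c unfolding LIMSEQ_iff by (metis diff_zero half_gt_zero real_norm_def)
    have "dist (\<Sum>i<k. a i * c i) (\<Sum>n. a n * c n) < e" if k: "k \<ge> N" and a: "a \<in> unit_ball ell1" for k a
    proof -
      have sum: "summable (\<lambda>n. \<bar>a n\<bar>)" and le: "(\<Sum>n. \<bar>a n\<bar>) \<le> 1"
        using a by (simp_all add: unit_ball_def ell1_def)
      have tail_le: "\<bar>a (n + k) * c (n + k)\<bar> \<le> e / 2 * \<bar>a (n + k)\<bar>" for n
        using mult_right_mono[of "\<bar>c (n + k)\<bar>" "e / 2" "\<bar>a (n + k)\<bar>"] N[of "n + k"] k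
        by (simp add: abs_mult mult.commute)
      have tail: "summable (\<lambda>n. \<bar>a (n + k)\<bar>)" using sum by (rule summable_ignore_initial_segment)
      then have tail': "summable (\<lambda>n. e / 2 * \<bar>a (n + k)\<bar>)" by (rule summable_mult)
      then have abs: "summable (\<lambda>n. \<bar>a (n + k) * c (n + k)\<bar>)"
        by (rule summable_comparison_test[rotated]) (use tail_le in auto)
      then have "summable (\<lambda>n. a (n + k) * c (n + k))" by (rule summable_rabs_cancel)
      then have "summable (\<lambda>n. a n * c n)" by (simp only: summable_iff_shift[of "\<lambda>n. a n * c n" k])
      then have "dist (\<Sum>i<k. a i * c i) (\<Sum>n. a n * c n) = \<bar>\<Sum>n. a (n + k) * c (n + k)\<bar>"
        using suminf_split_initial_segment[of "\<lambda>n. a n * c n" k] by (simp add: dist_real_def)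
      also have "\<dots> \<le> (\<Sum>n. \<bar>a (n + k) * c (n + k)\<bar>)" by (rule summable_rabs[OF abs])
      also have "\<dots> \<le> (\<Sum>n. e / 2 * \<bar>a (n + k)\<bar>)" by (rule suminf_le[OF tail_le abs tail'])
      also have "\<dots> = e / 2 * (\<Sum>n. \<bar>a (n + k)\<bar>)" by (rule suminf_mult[OF tail])
      also have "\<dots> \<le> e / 2 * 1"
      proof (rule mult_left_mono)
        have "0 \<le> (\<Sum>i<k. \<bar>a i\<bar>)" by (simp add: sum_nonneg)
        then show "(\<Sum>n. \<bar>a (n + k)\<bar>) \<le> 1"
          using suminf_split_initial_segment[OF sum, of k] le by linarith
      qed (use e in simp)
      finally show ?thesis using e by simp
    qed
    then show "\<forall>\<^sub>F k in sequentially. \<forall>a\<in>unit_ball ell1. dist (\<Sum>i<k. a i * c i) (\<Sum>n. a n * c n) < e"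
      unfolding eventually_sequentially by blast
  qed
qed simp

lemma weakly_compact_operator_of_weakly_null:
  fixes x :: "nat \<Rightarrow> 'x::banach"
  assumes x: "weakly_null x"
  shows "weakly_compact_operator ell1 (\<lambda>a. \<Sum>n. a n *\<^sub>R x n)"
proof -
  \<comment> \<open>Weakly null sequences are norm bounded, which makes the series defining the
    operator absolutely convergent.\<close>
  obtain M where M: "\<And>n. norm (x n) \<le> M"
    using weakly_null_imp_bounded[OF x] by (auto simp: bounded_iff)
  have le: "norm (a n *\<^sub>R x n) \<le> M * \<bar>a n\<bar>" for a n
    using mult_right_mono[OF M[of n], of "\<bar>a n\<bar>"] by (simp add: mult.commute)
  have normsum: "summable (\<lambda>n. norm (a n *\<^sub>R x n))" if "summable (\<lambda>n. \<bar>a n\<bar>)" for a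
    by (rule summable_comparison_test[OF _ summable_mult[OF that, of M]]) (use le in auto)
  have sum: "summable (\<lambda>n. a n *\<^sub>R x n)" if "summable (\<lambda>n. \<bar>a n\<bar>)" for a
    by (rule summable_norm_cancel[OF normsum[OF that]])
  let ?S = "\<lambda>a. \<Sum>n. a n *\<^sub>R x n"
  have "bounded_operator ell1 ?S"
    unfolding bounded_operator_def
  proof (intro conjI ballI allI exI[of _ M])
    fix a b :: "nat \<Rightarrow> real"
    assume "a \<in> vcarrier ell1" "b \<in> vcarrier ell1"
    then show "?S (vadd ell1 a b) = ?S a + ?S b"
      using suminf_add[OF sum[of a] sum[of b]] by (simp add: ell1_def scaleR_add_left)
  next
    fix c and a :: "nat \<Rightarrow> real"
    assume "a \<in> vcarrier ell1"
    then show "?S (vscale ell1 c a) = c *\<^sub>R ?S a"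
      using suminf_scaleR_right[OF sum[of a], of c] by (simp add: ell1_def)
  next
    fix a :: "nat \<Rightarrow> real"
    assume "a \<in> vcarrier ell1"
    then have a: "summable (\<lambda>n. \<bar>a n\<bar>)" by (simp add: ell1_def)
    have "norm (?S a) \<le> (\<Sum>n. norm (a n *\<^sub>R x n))" by (rule summable_norm[OF normsum[OF a]])
    also have "\<dots> \<le> (\<Sum>n. M * \<bar>a n\<bar>)"
      by (rule suminf_le[OF le[of a] normsum[OF a] summable_mult[OF a]])
    also have "\<dots> = M * vnorm ell1 a" by (simp add: ell1_def suminf_mult[OF a])
    finally show "norm (?S a) \<le> M * vnorm ell1 a" .
  qed
  moreover have "compactin weak_topology (?S ` unit_ball ell1)"
  proof (rule image_compactin)
    show "compactin (top_of_set (unit_ball ell1)) (unit_ball ell1)"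
      by (simp add: compactin_subtopology compact_unit_ball_ell1)
    show "continuous_map (top_of_set (unit_ball ell1)) weak_topology ?S"
    proof (rule continuous_map_into_weak_topology)
      fix f :: "'x \<Rightarrow>\<^sub>L real"
      \<comment> \<open>Testing with \<open>f\<close> turns the operator into the pairing with the
        coefficients f(x_n), which tend to 0.\<close>
      have "continuous_on (unit_ball ell1) (\<lambda>a. \<Sum>n. a n * blinfun_apply f (x n))"
        using x by (intro continuous_on_unit_ball_ell1_pairing) (simp add: weakly_null_iff)
      moreover have "(\<Sum>n. a n * blinfun_apply f (x n)) = blinfun_apply f (?S a)"
        if "a \<in> unit_ball ell1" for a
        using bounded_linear.suminf[OF blinfun.bounded_linear_right[of f] sum[of a]] that
        by (simp add: unit_ball_def ell1_def blinfun.scaleR_right)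
      ultimately have "continuous_on (unit_ball ell1) (\<lambda>a. blinfun_apply f (?S a))"
        by (simp cong: continuous_on_cong)
      then show "continuous_map (top_of_set (unit_ball ell1)) euclideanreal (\<lambda>a. blinfun_apply f (?S a))"
        by simp
    qed
  qed
  then have "relatively_weakly_compact (?S ` unit_ball ell1)"
    unfolding relatively_weakly_compact_def
    using compactin_imp_closedin[OF Hausdorff_weak_topology] closure_of_eq by metis
  ultimately show ?thesis by (simp add: weakly_compact_operator_def)
qed

subsection \<open>Weak almost limited operators\<close>

lemma weak_almost_limited_comp:
  assumes T: "weak_almost_limited T" and S: "weakly_compact_operator Z S"
  shows "almost_limited_operator Z (blinfun_apply T \<circ> S)"
  unfolding almost_limited_operator_def
proof
  have S': "bounded_operator Z S" using S by (simp add: weakly_compact_operator_def)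
  then obtain K where K: "\<forall>x\<in>vcarrier Z. norm (S x) \<le> K * vnorm Z x"
    by (auto simp: bounded_operator_def)
  have "norm (blinfun_apply T (S x)) \<le> (norm T * K) * vnorm Z x" if "x \<in> vcarrier Z" for x
  proof -
    have "norm (blinfun_apply T (S x)) \<le> norm T * norm (S x)" by (rule norm_blinfun)
    also have "\<dots> \<le> norm T * (K * vnorm Z x)" using K that by (intro mult_left_mono) auto
    finally show ?thesis by (simp add: mult.assoc)
  qed
  with S' show "bounded_operator Z (blinfun_apply T \<circ> S)"
    unfolding bounded_operator_def by (auto simp: blinfun.add_right blinfun.scaleR_right)
  show "almost_limited_set ((blinfun_apply T \<circ> S) ` unit_ball Z)"
    unfolding image_comp[symmetric]
    using T S by (simp add: weak_almost_limited_def weakly_compact_operator_def)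
qed

lemma almost_limited_on_ell1_imp_sequential:
  fixes T :: "'x::banach \<Rightarrow>\<^sub>L 'e::banach_lattice"
  assumes T: "\<And>S. weakly_compact_operator ell1 S \<Longrightarrow> almost_limited_operator ell1 (blinfun_apply T \<circ> S)"
    and x: "weakly_null x" and f: "disjoint_dual_seq f" "weak_star_null f"
  shows "(\<lambda>n. blinfun_apply (f n) (blinfun_apply T (x n))) \<longlonglongrightarrow> 0"
proof (rule LIMSEQ_I)
  fix e :: real assume "e > 0"
  let ?S = "\<lambda>a. \<Sum>n. a n *\<^sub>R x n"
  have "almost_limited_set ((blinfun_apply T \<circ> ?S) ` unit_ball ell1)"
    using T[OF weakly_compact_operator_of_weakly_null[OF x]] by (simp add: almost_limited_operator_def)
  with f have "uniform_limit ((blinfun_apply T \<circ> ?S) ` unit_ball ell1) (\<lambda>n. blinfun_apply (f n)) (\<lambda>x. 0) sequentially"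
    by (simp add: almost_limited_set_def)
  then obtain N where N: "\<And>n a. n \<ge> N \<Longrightarrow> a \<in> unit_ball ell1 \<Longrightarrow>
      \<bar>blinfun_apply (f n) (blinfun_apply T (?S a))\<bar> < e"
    using \<open>e > 0\<close> unfolding uniform_limit_iff eventually_sequentially by fastforce
  have "norm (blinfun_apply (f n) (blinfun_apply T (x n)) - 0) < e" if "n \<ge> N" for n
  proof -
    \<comment> \<open>The threshold \<open>N\<close> is uniform over the ball, so the point tested
      may vary with \<open>n\<close>.\<close>
    let ?a = "\<lambda>m. if m = n then 1 else 0 :: real"
    have "?a \<in> unit_ball ell1" by (simp add: unit_ball_ell1)
    moreover have "?S ?a = x n"
      using sums_unique[OF sums_single[of n x]] by (simp add: if_distrib[of "\<lambda>c. c *\<^sub>R _"] cong: if_cong)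
    ultimately show ?thesis using N[OF that, of ?a] by simp
  qed
  then show "\<exists>N. \<forall>n\<ge>N. norm (blinfun_apply (f n) (blinfun_apply T (x n)) - 0) < e" by blast
qed

lemma sequential_imp_weak_almost_limited:
  fixes T :: "'x::banach \<Rightarrow>\<^sub>L 'e::banach_lattice"
  assumes seq: "\<And>x f. weakly_null x \<Longrightarrow> disjoint_dual_seq f \<Longrightarrow> weak_star_null f \<Longrightarrow>
    (\<lambda>n. blinfun_apply (f n) (blinfun_apply T (x n))) \<longlonglongrightarrow> 0"
  shows "weak_almost_limited T"
  unfolding weak_almost_limited_def almost_limited_set_def
proof (intro allI impI conjI)
  fix A :: "'x set" assume A: "relatively_weakly_compact A"
  then have "bounded (weak_topology closure_of A)"
    by (simp add: relatively_weakly_compact_def weakly_compact_imp_bounded)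
  then have "bounded A" by (rule bounded_subset) (simp add: closure_of_subset)
  then show "bounded (blinfun_apply T ` A)"
    by (rule bounded_linear_image[OF _ blinfun.bounded_linear_right])
  fix f :: "nat \<Rightarrow> 'e \<Rightarrow>\<^sub>L real"
  assume f: "disjoint_dual_seq f \<and> weak_star_null f"
  show "uniform_limit (blinfun_apply T ` A) (\<lambda>n. blinfun_apply (f n)) (\<lambda>x. 0) sequentially"
  proof (rule uniform_limitI, rule ccontr)
    fix e :: real
    assume e: "e > 0"
      and "\<not> (\<forall>\<^sub>F n in sequentially. \<forall>y\<in>blinfun_apply T ` A. dist (blinfun_apply (f n) y) 0 < e)"
    then have "infinite {n. \<exists>x\<in>A. e \<le> \<bar>blinfun_apply (f n) (blinfun_apply T x)\<bar>}"
      by (simp add: eventually_cofinite not_less flip: cofinite_eq_sequentially)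
    from infinite_enumerate[OF this] obtain k :: "nat \<Rightarrow> nat"
      where k: "strict_mono k" "\<forall>n. \<exists>x\<in>A. e \<le> \<bar>blinfun_apply (f (k n)) (blinfun_apply T x)\<bar>"
      by auto
    then obtain x where x: "\<And>n. x n \<in> A" "\<And>n. e \<le> \<bar>blinfun_apply (f (k n)) (blinfun_apply T (x n))\<bar>"
      by metis
    obtain r z where r: "strict_mono r" and z: "limitin weak_topology (x \<circ> r) z sequentially"
      using relatively_weakly_compact_subseq[OF A x(1)] .
    \<comment> \<open>The point \<open>x (r n)\<close> was chosen for the functional with index
      \<open>k (r n)\<close>, so the functionals follow the composed subsequence.\<close>
    define g where "g = f \<circ> (k \<circ> r)"
    have "strict_mono (k \<circ> r)" using k(1) r by (rule strict_mono_o)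
    then have g: "disjoint_dual_seq g" "weak_star_null g"
      using f by (simp_all add: g_def disjoint_dual_seq_subseq weak_star_null_subseq)
    have "weakly_null (\<lambda>n. x (r n) - z)"
      unfolding weakly_null_iff blinfun.diff_right
    proof
      fix h :: "'x \<Rightarrow>\<^sub>L real"
      have "(\<lambda>n. blinfun_apply h (x (r n))) \<longlonglongrightarrow> blinfun_apply h z"
        using z by (simp add: limitin_weak_topology_iff)
      then show "(\<lambda>n. blinfun_apply h (x (r n)) - blinfun_apply h z) \<longlonglongrightarrow> 0" by (rule LIM_zero)
    qed
    \<comment> \<open>The first summand vanishes in the limit by the sequential condition, the
      second because \<open>g\<close> is weak* null and T z is fixed.\<close>
    from seq[OF this g]
    have "(\<lambda>n. blinfun_apply (g n) (blinfun_apply T (x (r n) - z)) + blinfun_apply (g n) (blinfun_apply T z)) \<longlonglongrightarrow> 0 + 0"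
      using g(2) by (intro tendsto_add) (auto simp: weak_star_null_iff)
    then have "(\<lambda>n. blinfun_apply (g n) (blinfun_apply T (x (r n)))) \<longlonglongrightarrow> 0"
      by (simp add: blinfun.diff_right)
    then have "\<forall>\<^sub>F n in sequentially. \<bar>blinfun_apply (g n) (blinfun_apply T (x (r n)))\<bar> < e"
      using e by (auto dest: tendstoD)
    then obtain n where "\<bar>blinfun_apply (g n) (blinfun_apply T (x (r n)))\<bar> < e"
      by (auto simp: eventually_sequentially)
    with x(2)[of "r n"] show False by (simp add: g_def)
  qed
qed

theorem theorem2p2:
  fixes T :: "'x::banach \<Rightarrow>\<^sub>L 'e::banach_lattice"
  shows
    "(weak_almost_limited T \<longleftrightarrow>
        (\<forall>(Z :: ('z + (nat \<Rightarrow> real)) normed_structure) S.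
          banach_space Z \<and> weakly_compact_operator Z S \<longrightarrow>
            almost_limited_operator Z (blinfun_apply T \<circ> S))) \<and>
     (weak_almost_limited T \<longleftrightarrow>
        (\<forall>S. weakly_compact_operator ell1 S \<longrightarrow>
            almost_limited_operator ell1 (blinfun_apply T \<circ> S))) \<and>
     (weak_almost_limited T \<longleftrightarrow>
        (\<forall>x f. weakly_null x \<and> disjoint_dual_seq f \<and> weak_star_null f \<longrightarrow>
            (\<lambda>n. blinfun_apply (f n) (blinfun_apply T (x n))) \<longlonglongrightarrow> 0))"
    (is "(?one \<longleftrightarrow> ?two) \<and> (?one \<longleftrightarrow> ?three) \<and> (?one \<longleftrightarrow> ?four)")
proof -
  have "?one \<Longrightarrow> ?two" by (auto intro: weak_almost_limited_comp)
  moreover have "?two \<Longrightarrow> ?three"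
  proof (intro allI impI)
    fix S :: "(nat \<Rightarrow> real) \<Rightarrow> 'x"
    assume two: ?two and S: "weakly_compact_operator ell1 S"
    \<comment> \<open>The right injection carries l^1 onto a structure over which (2) quantifies;
      the left summand \<open>'z\<close> is left untouched.\<close>
    let ?h = "Inr :: (nat \<Rightarrow> real) \<Rightarrow> 'z + (nat \<Rightarrow> real)"
    have "almost_limited_operator (transport_structure ?h ell1) (blinfun_apply T \<circ> (S \<circ> inv ?h))"
      using two S banach_space_transport[OF banach_space_ell1, of ?h]
        weakly_compact_operator_transport[of ?h ell1 S] by simp
    then show "almost_limited_operator ell1 (blinfun_apply T \<circ> S)"
      using almost_limited_operator_transport[of ?h ell1 "blinfun_apply T \<circ> S"] by (simp add: o_assoc)
  qed
  moreover have "?three \<Longrightarrow> ?four" by (auto intro: almost_limited_on_ell1_imp_sequential)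
  moreover have "?four \<Longrightarrow> ?one" by (auto intro: sequential_imp_weak_almost_limited)
  ultimately show ?thesis by argo
qed

end
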